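(* For every $n\ge 6$ there exists no weakly symmetric subspace extension of the permutahedron $\Pi_n$ (with respect to the group $G=S_n$ acting on the vertices by permuting coordinates) with fewer than $\frac{n(n-1)}{2}$ variables; i.e. every weakly symmetric subspace extension $Q\subseteq\mathbb{R}^d$ of $\Pi_n$ satisfies $d\ge\frac{n(n-1)}{2}$.
   Context: The permutahedron $\Pi_n$ is the convex hull of all points of $\mathbb{R}^n$ obtained from $(1,2,\dots,n)$ by permuting coordinates; its vertex set is $X=\{(\zeta^{-1}(1),\dots,\zeta^{-1}(n)) : \zeta\in S_n\}$. The group $S_n$ acts on $\mathbb{R}^n$ by $(\pi.x)_v=x_{\pi^{-1}(v)}$, and $S_d$ acts on $\mathbb{R}^d$ by $(\varkappa.y)_j=y_{\varkappa^{-1}(j)}$. An extension of a polytope $P\subseteq\mathbb{R}^m$ is a polytope $Q\subseteq\mathbb{R}^d$ with a linear map $p:\mathbb{R}^d\to\mathbb{R}^m$ such that $p(Q)=P$; it is a subspace extension if $Q$ is the intersection of an affine subspace of $\mathbb{R}^d$ with the nonnegative orthant $\mathbb{R}^d_+$. A section is a map $s:X\to Q$ with $s(x)\in Q\cap p^{-1}(x)$ for all vertices $x\in X$ of $P$. The extension is weakly symmetric with respect to a group $G\subseteq S_m$ acting on $X$ if there is a section $s:X\to Q$ such that for every $\pi\in G$ there is $\varkappa_\pi\in S_d$ with $s(\pi.x)=\varkappa_\pi.s(x)$ for all $x\in X$. *)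

theory Defs
  imports "HOL-Analysis.Analysis"
begin

text \<open>Vertex set X of the permutahedron Pi_n: all points of R^n whose coordinates
  are a permutation of 1,...,n.  Coordinates are indexed by the finite type 'n,
  n = CARD('n).  A bijection zeta from coordinates to {1..n} gives the vertex
  (zeta v)_v, which is the paper's (zeta^{-1}(1),...,zeta^{-1}(n)) after renaming.\<close>
definition permutahedron_vertices :: "(real ^ 'n::finite) set" where
  "permutahedron_vertices =
     {x. \<exists>\<sigma>::'n \<Rightarrow> nat. bij_betw \<sigma> UNIV {1..CARD('n)} \<and> x = (\<chi> v. real (\<sigma> v))}"

definition permutahedron :: "(real ^ 'n::finite) set" where
  "permutahedron = convex hull permutahedron_vertices"

definition perm_act :: "('i::finite \<Rightarrow> 'i) \<Rightarrow> real ^ 'i \<Rightarrow> real ^ 'i" where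
  "perm_act \<pi> x = (\<chi> v. x $ (inv \<pi> v))"

definition is_extension ::
  "(real ^ 'd::finite) set \<Rightarrow> (real ^ 'd \<Rightarrow> real ^ 'm::finite) \<Rightarrow> (real ^ 'm) set \<Rightarrow> bool" where
  "is_extension Q p P \<longleftrightarrow> polytope Q \<and> linear p \<and> p ` Q = P"

definition is_subspace_extension ::
  "(real ^ 'd::finite) set \<Rightarrow> (real ^ 'd \<Rightarrow> real ^ 'm::finite) \<Rightarrow> (real ^ 'm) set \<Rightarrow> bool" where
  "is_subspace_extension Q p P \<longleftrightarrow> is_extension Q p P \<and>
     (\<exists>A. affine A \<and> Q = A \<inter> {y. \<forall>j. 0 \<le> y $ j})"

definition is_section ::
  "(real ^ 'm::finite \<Rightarrow> real ^ 'd::finite) \<Rightarrow> (real ^ 'd) set \<Rightarrow> (real ^ 'd \<Rightarrow> real ^ 'm)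
     \<Rightarrow> (real ^ 'm) set \<Rightarrow> bool" where
  "is_section s Q p X \<longleftrightarrow> (\<forall>x\<in>X. s x \<in> Q \<and> p (s x) = x)"

definition weakly_symmetric ::
  "(real ^ 'd::finite) set \<Rightarrow> (real ^ 'd \<Rightarrow> real ^ 'm::finite) \<Rightarrow> (real ^ 'm) set
     \<Rightarrow> ('m \<Rightarrow> 'm) set \<Rightarrow> bool" where
  "weakly_symmetric Q p X G \<longleftrightarrow>
     (\<exists>s. is_section s Q p X \<and>
        (\<forall>\<pi>\<in>G. \<exists>\<kappa>::'d \<Rightarrow> 'd. bij \<kappa> \<and>
           (\<forall>x\<in>X. s (perm_act \<pi> x) = perm_act \<kappa> (s x))))"

end

theory Submission
  imports Defs
begin

text \<open>
  Describe a vertex by a labeling, a bijection \<open>\<sigma>\<close> from the coordinates to \<open>{1..n}\<close>. The supports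
  of the components of a weakly symmetric section are sets of labelings, and the symmetric group
  permutes these sets. If a labeling \<open>\<rho>\<close> is not on the facet \<open>\<sigma> ` S = {1..k}\<close>, \<open>k = card S\<close>, then
  some support contains \<open>\<rho>\<close> and misses the facet: otherwise the lifted facet could be pushed across
  the facet inequality inside \<open>Q\<close>.

  The stabiliser of such a support cannot be transitive on sets of size \<open>k\<close>. Orbit counting shows
  that, with fewer than \<open>n (n - 1) / 2\<close> supports, it then fixes a single point \<open>v\<close> and is transitive
  on equal-sized subsets of the other points. For \<open>\<rho> ` S = {1, ..., k - 1, k + 1}\<close> this forces the
  least value of \<open>\<sigma> v\<close> on the support to be \<open>k + 1\<close>, or the greatest one to be \<open>k\<close>. By symmetry
  this happens for every pair \<open>(k, v)\<close> with \<open>0 < k < n\<close>, while one support serves at most two pairs;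
  so there are at least \<open>n (n - 1) / 2\<close> supports.
\<close>

subsection \<open>Actions of the symmetric group\<close>

lemma ex_permutes_image:
  assumes "finite A" "I \<subseteq> A" "J \<subseteq> A" "card I = card J"
  obtains \<pi> where "\<pi> permutes A" "\<pi> ` I = J"
proof -
  have fin: "finite I" "finite J" using assms by (auto intro: finite_subset)
  obtain f where f: "bij_betw f I J"
    using finite_same_card_bij[OF fin assms(4)] by blast
  have "card (A - I) = card (A - J)" using assms fin by (simp add: card_Diff_subset)
  then obtain g where g: "bij_betw g (A - I) (A - J)"
    using finite_same_card_bij assms(1) by (metis finite_Diff)
  define \<pi> where "\<pi> = restrict_id (\<lambda>x. if x \<in> I then f x else g x) A"
  have "bij_betw (\<lambda>x. if x \<in> I then f x else g x) (I \<union> (A - I)) (J \<union> (A - J))"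
    using f g by (rule bij_betw_disjoint_Un) auto
  moreover have "I \<union> (A - I) = A" "J \<union> (A - J) = A" using assms by auto
  ultimately have "\<pi> permutes A" unfolding \<pi>_def by (metis permutes_restrict_id)
  moreover have "\<pi> ` I = f ` I"
    using assms(2) by (intro image_cong) (auto simp: \<pi>_def restrict_id_def)
  ultimately show thesis using that f by (simp add: bij_betw_imp_surj_on)
qed

lemma binomial_le_binomial:
  assumes "j \<le> i" "i + j \<le> n"
  shows "n choose j \<le> n choose i"
proof (cases "2 * i \<le> n")
  case False
  then have "n choose j \<le> n choose (n - i)" using assms by (intro binomial_mono) auto
  then show ?thesis using binomial_symmetric[of i n] assms by simp
qed (use assms in \<open>simp add: binomial_mono\<close>)

lemma card_eq_card_image_mult:
  fixes H K :: "('a \<Rightarrow> 'a) set"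
  assumes fin: "finite H"
    and bij: "\<And>h. h \<in> H \<Longrightarrow> bij h"
    and closed: "\<And>h k. h \<in> H \<Longrightarrow> k \<in> K \<Longrightarrow> h \<circ> k \<in> H"
    and fibre: "\<And>g h. g \<in> H \<Longrightarrow> h \<in> H \<Longrightarrow> F g = F h \<longleftrightarrow> inv h \<circ> g \<in> K"
  shows "card H = card (F ` H) * card K"
proof -
  have "card {g \<in> H. F g = F h} = card K" if h: "h \<in> H" for h
  proof -
    have inv: "h \<circ> (inv h \<circ> g) = g" "inv h \<circ> (h \<circ> g) = g" for g :: "'a \<Rightarrow> 'a"
      using bij[OF h] by (simp_all add: fun_eq_iff bij_is_inj bij_is_surj surj_f_inv_f)
    have "{g \<in> H. F g = F h} = (\<circ>) h ` K"
    proof (intro equalityI subsetI)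
      fix g assume "g \<in> {g \<in> H. F g = F h}"
      then have "inv h \<circ> g \<in> K" using fibre h by blast
      then show "g \<in> (\<circ>) h ` K" using inv(1)[of g] by (metis imageI)
    next
      fix g assume "g \<in> (\<circ>) h ` K"
      then obtain k where "k \<in> K" "g = h \<circ> k" by blast
      then show "g \<in> {g \<in> H. F g = F h}" using h closed fibre by (simp add: inv(2))
    qed
    moreover have "inj_on ((\<circ>) h) K" by (rule inj_onI) (metis inv(2))
    ultimately show ?thesis by (simp add: card_image)
  qed
  then have "(\<Sum>y\<in>F ` H. card {g \<in> H. F g = y}) = (\<Sum>y\<in>F ` H. card K)"
    by (intro sum.cong) auto
  moreover have "card H = (\<Sum>y\<in>F ` H. card {g \<in> H. F g = y})"
    using sum.image_gen[OF fin, of "\<lambda>_. 1 :: nat" F] by simp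
  ultimately show ?thesis by simp
qed

locale sym_action =
  fixes act :: "('v::finite \<Rightarrow> 'v) \<Rightarrow> 'x \<Rightarrow> 'x"
  assumes act_id [simp]: "act id x = x"
    and act_comp: "bij \<pi> \<Longrightarrow> bij \<rho> \<Longrightarrow> act (\<pi> \<circ> \<rho>) x = act \<pi> (act \<rho> x)"
begin

definition stab :: "'v set \<Rightarrow> 'x \<Rightarrow> ('v \<Rightarrow> 'v) set" where
  "stab A x = {u. u permutes A \<and> act u x = x}"

definition orb :: "'v set \<Rightarrow> 'x \<Rightarrow> 'x set" where
  "orb A x = (\<lambda>\<pi>. act \<pi> x) ` {\<pi>. \<pi> permutes A}"

definition point_orb :: "'v set \<Rightarrow> 'x \<Rightarrow> 'v \<Rightarrow> 'v set" where
  "point_orb A x a = (\<lambda>u. u a) ` stab A x"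

definition transitive_on :: "'v set \<Rightarrow> 'x \<Rightarrow> bool" where
  "transitive_on A x \<longleftrightarrow> (\<forall>a\<in>A. point_orb A x a = A)"

definition fixed_points :: "'v set \<Rightarrow> 'x \<Rightarrow> 'v set" where
  "fixed_points A x = {a \<in> A. \<forall>u\<in>stab A x. u a = a}"

lemma act_inv: "bij \<pi> \<Longrightarrow> act (inv \<pi>) (act \<pi> x) = x"
  by (metis act_comp act_id bij_imp_bij_inv bij_is_inj inv_o_cancel)

lemma act_eq_act_iff:
  assumes "bij \<pi>" "bij \<rho>"
  shows "act \<pi> x = act \<rho> y \<longleftrightarrow> act (inv \<rho> \<circ> \<pi>) x = y"
proof -
  have "act (inv \<rho> \<circ> \<pi>) x = act (inv \<rho>) (act \<pi> x)"
    using assms by (intro act_comp bij_imp_bij_inv)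
  moreover have "act \<rho> (act (inv \<rho>) z) = z" for z
    using assms(2) act_inv[of "inv \<rho>" z] by (simp add: bij_imp_bij_inv inv_inv_eq)
  ultimately show ?thesis using act_inv[OF assms(2)] by metis
qed

lemma stab_permutes: "u \<in> stab A x \<Longrightarrow> u permutes A"
  by (simp add: stab_def)

lemma stab_bij: "u \<in> stab A x \<Longrightarrow> bij u"
  by (meson permutes_bij stab_permutes)

lemma stab_inv_apply:
  assumes "u \<in> stab A x"
  shows "u (inv u a) = a" "inv u (u a) = a"
  using permutes_inverses[OF stab_permutes[OF assms]] by simp_all

lemma stab_id: "id \<in> stab A x"
  by (simp add: stab_def)

lemma stab_comp: "u \<in> stab A x \<Longrightarrow> w \<in> stab A x \<Longrightarrow> u \<circ> w \<in> stab A x"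
  using act_comp[of u w x] by (auto simp: stab_def permutes_compose permutes_bij)

lemma stab_inv: "u \<in> stab A x \<Longrightarrow> inv u \<in> stab A x"
  using act_inv[of u x] by (auto simp: stab_def permutes_inv permutes_bij)

lemma stab_mono: "A \<subseteq> B \<Longrightarrow> stab A x \<subseteq> stab B x"
  unfolding stab_def using permutes_subset by blast

lemma stab_remove: "stab (A - {a}) x = {u \<in> stab A x. u a = a}"
  unfolding stab_def by (auto simp: permutes_def)

lemma finite_stab: "finite (stab A x)"
  by (rule finite_subset[of _ "{u. u permutes A}"]) (auto simp: stab_def finite_permutations)

lemma card_stab_pos: "0 < card (stab A x)"
  using stab_id[of A x] finite_stab[of A x] by (auto simp: card_gt_0_iff)

lemma orb_mono: "A \<subseteq> B \<Longrightarrow> orb A x \<subseteq> orb B x"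
  unfolding orb_def using permutes_subset by blast

lemma finite_orb: "finite (orb A x)"
  by (simp add: orb_def finite_permutations)

lemma orb_subset_if_closed:
  assumes "\<And>z \<pi>. z \<in> C \<Longrightarrow> bij \<pi> \<Longrightarrow> act \<pi> z \<in> C" "x \<in> C"
  shows "orb A x \<subseteq> C"
  using assms by (auto simp: orb_def permutes_bij)

lemma orb_self: "x \<in> orb A x"
  unfolding orb_def by (rule image_eqI[of _ _ id]) simp_all

lemma card_orb_pos: "0 < card (orb A x)"
  using orb_self[of x A] finite_orb[of A x] by (auto simp: card_gt_0_iff)

lemma transpose_in_orb: "a \<in> A \<Longrightarrow> b \<in> A \<Longrightarrow> act (Transposition.transpose a b) x \<in> orb A x"
  unfolding orb_def by (rule imageI) (simp add: permutes_swap_id)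

lemma card_orb_stab: "card (orb A x) * card (stab A x) = fact (card A)"
proof -
  have "card {\<pi>. \<pi> permutes A} = card (orb A x) * card (stab A x)"
    unfolding orb_def
  proof (rule card_eq_card_image_mult)
    fix \<pi> \<rho> assume "\<pi> \<in> {\<pi>. \<pi> permutes A}" "\<rho> \<in> {\<pi>. \<pi> permutes A}"
    then show "act \<pi> x = act \<rho> x \<longleftrightarrow> inv \<rho> \<circ> \<pi> \<in> stab A x"
      by (simp add: act_eq_act_iff permutes_bij stab_def permutes_compose permutes_inv)
  qed (auto simp: permutes_bij permutes_compose stab_def finite_permutations)
  then show ?thesis by (simp add: card_permutations)
qed

lemma card_point_orb: "card (point_orb A x a) * card (stab (A - {a}) x) = card (stab A x)"
  unfolding point_orb_def
proof (rule card_eq_card_image_mult[symmetric])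
  fix u w assume uw: "u \<in> stab A x" "w \<in> stab A x"
  then have "u a = w a \<longleftrightarrow> inv w (u a) = a" by (metis stab_inv_apply)
  then show "u a = w a \<longleftrightarrow> inv w \<circ> u \<in> stab (A - {a}) x"
    using uw by (simp add: stab_remove stab_comp stab_inv)
next
  fix u w assume "u \<in> stab A x" "w \<in> stab (A - {a}) x"
  then show "u \<circ> w \<in> stab A x" by (simp add: stab_remove stab_comp)
qed (simp_all add: finite_stab stab_bij)

lemma card_orb_remove:
  assumes "a \<in> A"
  shows "card (orb A x) * card (point_orb A x a) = card A * card (orb (A - {a}) x)"
proof -
  have "fact (card A) = card A * fact (card (A - {a}))"
    using assms fact_reduce[of "card A", where ?'a = nat] by (auto simp: card_gt_0_iff)
  then have "card (orb A x) * card (stab A x) =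
      card A * (card (orb (A - {a}) x) * card (stab (A - {a}) x))"
    by (simp only: card_orb_stab)
  then have "(card (orb A x) * card (point_orb A x a)) * card (stab (A - {a}) x) =
      (card A * card (orb (A - {a}) x)) * card (stab (A - {a}) x)"
    by (simp only: card_point_orb[of A x a, symmetric] mult.assoc)
  then show ?thesis using card_stab_pos[of "A - {a}" x] by (metis mult_right_cancel less_irrefl)
qed

lemma card_orb_remove_transitive:
  assumes "a \<in> A" "transitive_on A x"
  shows "card (orb (A - {a}) x) = card (orb A x)"
proof -
  have "card A > 0" using assms(1) by (auto simp: card_gt_0_iff)
  then show ?thesis using assms card_orb_remove[of a A x] by (auto simp: transitive_on_def)
qed

lemma point_orb_self: "a \<in> point_orb A x a"
  unfolding point_orb_def using stab_id by (intro image_eqI[of _ _ id]) auto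

lemma card_orb_remove_fixed_point:
  assumes "a \<in> fixed_points A x"
  shows "card (orb A x) = card A * card (orb (A - {a}) x)"
proof -
  have "point_orb A x a = {a}"
    using assms point_orb_self[of a A x] by (auto simp: fixed_points_def point_orb_def)
  then show ?thesis using card_orb_remove[of a A x] assms by (simp add: fixed_points_def)
qed

lemma point_orb_subset: "a \<in> A \<Longrightarrow> point_orb A x a \<subseteq> A"
  unfolding point_orb_def by (auto dest: stab_permutes simp: permutes_in_image)

lemma stab_image_point_orb:
  assumes u: "u \<in> stab A x"
  shows "u ` point_orb A x a = point_orb A x a"
proof (rule card_subset_eq)
  show "u ` point_orb A x a \<subseteq> point_orb A x a"
  proof clarify
    fix b assume "b \<in> point_orb A x a"
    then obtain w where "w \<in> stab A x" "b = w a" by (auto simp: point_orb_def)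
    then show "u b \<in> point_orb A x a"
      unfolding point_orb_def using stab_comp[OF u, of w] by (metis comp_apply imageI)
  qed
  show "card (u ` point_orb A x a) = card (point_orb A x a)"
    by (rule card_image) (rule inj_on_subset[OF bij_is_inj[OF stab_bij[OF u]]], simp)
qed simp

lemma transitive_onI:
  assumes "\<And>a b. a \<in> A \<Longrightarrow> b \<in> A \<Longrightarrow> \<exists>u\<in>stab A x. u a = b"
  shows "transitive_on A x"
proof -
  have "b \<in> point_orb A x a" if "a \<in> A" "b \<in> A" for a b
    using assms[OF that] unfolding point_orb_def by blast
  then show ?thesis
    unfolding transitive_on_def using point_orb_subset by (metis subsetI subset_antisym)
qed

lemma transitive_onE:
  assumes "transitive_on A x" "a \<in> A" "b \<in> A"
  obtains u where "u \<in> stab A x" "u a = b"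
proof -
  have "b \<in> point_orb A x a" using assms by (simp add: transitive_on_def)
  then show thesis using that by (auto simp: point_orb_def)
qed

lemma transitive_on_if_large_point_orbs:
  assumes large: "\<And>a. a \<in> A \<Longrightarrow> card A < 2 * card (point_orb A x a)"
  shows "transitive_on A x"
proof (rule transitive_onI)
  fix a b assume ab: "a \<in> A" "b \<in> A"
  have "point_orb A x a \<inter> point_orb A x b \<noteq> {}"
  proof
    assume "point_orb A x a \<inter> point_orb A x b = {}"
    then have "card (point_orb A x a) + card (point_orb A x b) =
        card (point_orb A x a \<union> point_orb A x b)"
      by (simp add: card_Un_disjoint)
    also have "\<dots> \<le> card A" using ab point_orb_subset by (intro card_mono) auto
    finally show False using large[OF ab(1)] large[OF ab(2)] by linarith
  qed
  then obtain u w where "u \<in> stab A x" "w \<in> stab A x" "u a = w b"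
    unfolding point_orb_def by blast
  then show "\<exists>u\<in>stab A x. u a = b"
    by (intro bexI[of _ "inv w \<circ> u"]) (simp_all add: stab_comp stab_inv stab_inv_apply)
qed

lemma binomial_le_card_orb:
  assumes I: "I \<subseteq> A" "\<And>u. u \<in> stab A x \<Longrightarrow> u ` I = I"
  shows "card A choose card I \<le> card (orb A x)"
proof -
  have "card {J. J \<subseteq> A \<and> card J = card I} \<le> card (orb A x)"
  proof (rule card_le_if_inj_on_rel[where r = "\<lambda>J y. \<exists>\<pi>. \<pi> permutes A \<and> \<pi> ` I = J \<and> act \<pi> x = y"])
    fix J assume "J \<in> {J. J \<subseteq> A \<and> card J = card I}"
    then obtain \<pi> where "\<pi> permutes A" "\<pi> ` I = J" using ex_permutes_image[of A I J] I(1) by auto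
    then show "\<exists>y. y \<in> orb A x \<and> (\<exists>\<pi>. \<pi> permutes A \<and> \<pi> ` I = J \<and> act \<pi> x = y)"
      by (auto simp: orb_def)
  next
    fix J J' y
    assume "\<exists>\<pi>. \<pi> permutes A \<and> \<pi> ` I = J \<and> act \<pi> x = y"
    then obtain \<pi> where \<pi>: "\<pi> permutes A" "\<pi> ` I = J" "act \<pi> x = y" by blast
    assume "\<exists>\<pi>. \<pi> permutes A \<and> \<pi> ` I = J' \<and> act \<pi> x = y"
    then obtain \<rho> where \<rho>: "\<rho> permutes A" "\<rho> ` I = J'" "act \<rho> x = y" by blast
    have "act \<pi> x = act \<rho> x" using \<pi>(3) \<rho>(3) by simp
    then have "inv \<rho> \<circ> \<pi> \<in> stab A x"
      using \<pi>(1) \<rho>(1)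
      by (simp add: act_eq_act_iff permutes_bij stab_def permutes_compose permutes_inv)
    then have "inv \<rho> ` J = I" using I(2) \<pi>(2) by (metis image_comp)
    then show "J = J'"
      using \<rho>(2) image_f_inv_f[OF permutes_surj[OF \<rho>(1)], of J] by simp
  qed (rule finite_orb)
  then show ?thesis by (simp add: n_subsets)
qed

lemma intransitive_invariant_subset:
  assumes "\<not> transitive_on A x"
  obtains I where "I \<subset> A" "I \<noteq> {}" "\<And>u. u \<in> stab A x \<Longrightarrow> u ` I = I"
proof -
  obtain a where "a \<in> A" "point_orb A x a \<noteq> A"
    using assms by (auto simp: transitive_on_def)
  then show thesis
    using that[of "point_orb A x a"] stab_image_point_orb point_orb_subset[of a A x] point_orb_self
    by blast
qed

lemma card_le_card_orb_if_intransitive: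
  assumes "\<not> transitive_on A x"
  shows "card A \<le> card (orb A x)"
proof -
  obtain I where I: "I \<subset> A" "I \<noteq> {}" "\<And>u. u \<in> stab A x \<Longrightarrow> u ` I = I"
    using intransitive_invariant_subset[OF assms] by metis
  have "card I < card A" "card I > 0" using I by (simp_all add: psubset_card_mono card_gt_0_iff)
  then have "card A choose 1 \<le> card A choose card I" by (intro binomial_le_binomial) auto
  also have "\<dots> \<le> card (orb A x)"
    by (rule binomial_le_card_orb[OF psubset_imp_subset[OF I(1)] I(3)])
  finally show ?thesis by simp
qed

lemma fixed_points_nonempty_if_small_orb:
  assumes small: "2 * card (orb A x) < card A * (card A - 1)" and "\<not> transitive_on A x"
  shows "fixed_points A x \<noteq> {}"
proof -
  obtain I where I: "I \<subset> A" "I \<noteq> {}" "\<And>u. u \<in> stab A x \<Longrightarrow> u ` I = I"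
    using intransitive_invariant_subset[OF assms(2)] by metis
  have lt: "card I < card A" and pos: "card I > 0"
    using I by (simp_all add: psubset_card_mono card_gt_0_iff)
  have "2 * (card A choose 2) = card A * (card A - 1)"
    by (cases "card A") (simp_all add: choose_two)
  moreover have "card A choose card I \<le> card (orb A x)"
    by (rule binomial_le_card_orb[OF psubset_imp_subset[OF I(1)] I(3)])
  ultimately have "\<not> (2 \<le> card I \<and> card I + 2 \<le> card A)"
    using binomial_le_binomial[of 2 "card I" "card A"] small by linarith
  then consider "card I = 1" | "card (A - I) = 1"
    using lt pos I(1) by (fastforce simp: card_Diff_subset)
  moreover have "u ` (A - I) = A - I" if u: "u \<in> stab A x" for u
    using stab_permutes[OF u] I(3)[OF u] by (simp add: image_set_diff permutes_inj permutes_image)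
  ultimately obtain a where "{a} \<subseteq> A" "\<And>u. u \<in> stab A x \<Longrightarrow> u ` {a} = {a}"
    using I(1,3) by (metis Diff_subset card_1_singletonE psubset_imp_subset)
  then show ?thesis by (auto simp: fixed_points_def)
qed

lemma card_fixed_points_le_1:
  assumes "card (orb A x) < card A * (card A - 1)"
  shows "card (fixed_points A x) \<le> 1"
proof (rule ccontr)
  assume "\<not> card (fixed_points A x) \<le> 1"
  then obtain a b where ab: "a \<in> fixed_points A x" "b \<in> fixed_points A x" "a \<noteq> b"
    by (metis card_le_Suc0_iff_eq finite One_nat_def)
  have "b \<in> fixed_points (A - {a}) x" using ab by (auto simp: fixed_points_def stab_remove)
  then have "card (orb A x) = card A * ((card A - 1) * card (orb (A - {a} - {b}) x))"
    using ab(1) by (simp add: card_orb_remove_fixed_point fixed_points_def)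
  then show False using assms card_orb_pos[of "A - {a} - {b}" x] by simp
qed

subsection \<open>Exchangeable points\<close>

definition same_orbit :: "'x \<Rightarrow> 'v set \<Rightarrow> 'v set \<Rightarrow> bool" where
  "same_orbit x S T \<longleftrightarrow> (\<exists>u\<in>stab UNIV x. u ` S = T)"

definition exch :: "'x \<Rightarrow> 'v \<Rightarrow> 'v \<Rightarrow> bool" where
  "exch x a b \<longleftrightarrow> (\<forall>T. a \<in> T \<longrightarrow> b \<notin> T \<longrightarrow> same_orbit x T (insert b (T - {a})))"

definition exch_free :: "'x \<Rightarrow> bool" where
  "exch_free x \<longleftrightarrow> (\<forall>a b. exch x a b \<longrightarrow> a = b)"

lemma same_orbitI: "u \<in> stab A x \<Longrightarrow> u ` S = T \<Longrightarrow> same_orbit x S T"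
  unfolding same_orbit_def using stab_mono[of A UNIV x] by blast

lemma same_orbit_refl: "same_orbit x S S"
  using stab_id by (rule same_orbitI) simp

lemma same_orbit_sym:
  assumes "same_orbit x S T"
  shows "same_orbit x T S"
proof -
  obtain u where u: "u \<in> stab UNIV x" "u ` S = T" using assms by (auto simp: same_orbit_def)
  then have "inv u ` T = S" by (metis bij_is_inj image_inv_f_f stab_bij)
  with stab_inv[OF u(1)] show ?thesis by (rule same_orbitI)
qed

lemma same_orbit_trans:
  assumes "same_orbit x S T" "same_orbit x T U"
  shows "same_orbit x S U"
proof -
  obtain u where u: "u \<in> stab UNIV x" "u ` S = T" using assms(1) by (auto simp: same_orbit_def)
  obtain w where w: "w \<in> stab UNIV x" "w ` T = U" using assms(2) by (auto simp: same_orbit_def)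
  have "(w \<circ> u) ` S = U" using u(2) w(2) by (simp only: image_comp[symmetric])
  with stab_comp[OF w(1) u(1)] show ?thesis by (rule same_orbitI)
qed

lemma same_orbit_ComplD:
  assumes "same_orbit x (- S) (- T)"
  shows "same_orbit x S T"
proof -
  obtain u where u: "u \<in> stab UNIV x" "u ` (- S) = - T" using assms by (auto simp: same_orbit_def)
  then have "u ` S = T" by (metis bij_image_Compl_eq double_complement stab_bij)
  with u(1) show ?thesis by (rule same_orbitI)
qed

lemma exchD: "exch x a b \<Longrightarrow> a \<in> T \<Longrightarrow> b \<notin> T \<Longrightarrow> same_orbit x T (insert b (T - {a}))"
  by (simp add: exch_def)

lemma exch_refl: "exch x a a"
  by (simp add: exch_def)

lemma exch_sym:
  assumes "exch x a b"
  shows "exch x b a"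
  unfolding exch_def
proof (intro allI impI)
  fix T assume T: "b \<in> T" "a \<notin> T"
  have "same_orbit x (insert a (T - {b})) (insert b (insert a (T - {b}) - {a}))"
    using T by (intro exchD[OF assms]) auto
  moreover have "insert b (insert a (T - {b}) - {a}) = T" using T by auto
  ultimately show "same_orbit x T (insert a (T - {b}))" by (simp add: same_orbit_sym)
qed

lemma exch_trans:
  assumes ab: "exch x a b" and bc: "exch x b c"
  shows "exch x a c"
proof (cases "a = b \<or> b = c")
  case False
  show ?thesis unfolding exch_def
  proof (intro allI impI)
    fix T assume T: "a \<in> T" "c \<notin> T"
    then have "a \<noteq> c" by blast
    show "same_orbit x T (insert c (T - {a}))"
    proof (cases "b \<in> T")
      case True
      have "same_orbit x T (insert c (T - {b}))" using exchD[OF bc True T(2)] .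
      moreover have "same_orbit x (insert c (T - {b})) (insert b (insert c (T - {b}) - {a}))"
        using False T by (intro exchD[OF ab]) auto
      moreover have "insert b (insert c (T - {b}) - {a}) = insert c (T - {a})"
        using False True \<open>a \<noteq> c\<close> by auto
      ultimately show ?thesis using same_orbit_trans by metis
    next
      case notin: False
      have "same_orbit x T (insert b (T - {a}))" using exchD[OF ab T(1) notin] .
      moreover have "same_orbit x (insert b (T - {a})) (insert c (insert b (T - {a}) - {b}))"
        using False T by (intro exchD[OF bc]) auto
      moreover have "insert c (insert b (T - {a}) - {b}) = insert c (T - {a})"
        using notin by auto
      ultimately show ?thesis using same_orbit_trans by metis
    qed
  qed
qed (use assms in auto)

lemma exch_stab:
  assumes ab: "exch x a b" and u: "u \<in> stab UNIV x"
  shows "exch x (u a) (u b)"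
  unfolding exch_def
proof (intro allI impI)
  fix T assume T: "u a \<in> T" "u b \<notin> T"
  define S where "S = inv u ` T"
  have uS: "u ` S = T" unfolding S_def by (rule image_f_inv_f) (rule bij_is_surj[OF stab_bij[OF u]])
  have inj: "inj u" using stab_bij[OF u] by (rule bij_is_inj)
  have "a \<in> S" "b \<notin> S" using T uS inj_image_mem_iff[OF inj] by metis+
  then have "same_orbit x S (insert b (S - {a}))" by (rule exchD[OF ab])
  moreover have "same_orbit x T S" by (rule same_orbit_sym[OF same_orbitI[OF u uS]])
  moreover have "same_orbit x (insert b (S - {a})) (insert (u b) (T - {u a}))"
    using u by (rule same_orbitI) (simp add: image_set_diff inj uS)
  ultimately show "same_orbit x T (insert (u b) (T - {u a}))" using same_orbit_trans by blast
qed

lemma exch_if_stab_triple: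
  assumes u: "u \<in> stab {a, b, c} x" and ua: "u a = b"
  shows "exch x a b"
  unfolding exch_def
proof (intro allI impI)
  fix T assume T: "a \<in> T" "b \<notin> T"
  have outside: "w ` (T - {a, b, c}) = T - {a, b, c}" if "w permutes {a, b, c}" for w
    using permutes_not_in[OF that] by force
  note u_perm = stab_permutes[OF u]
  show "same_orbit x T (insert b (T - {a}))"
  proof (cases "c \<in> T")
    case True
    note inv_perm = permutes_inv[OF u_perm]
    have "inv u ` ({a, b, c} - {b}) = {a, b, c} - {a}"
      using ua stab_inv_apply(2)[OF u, of a] permutes_inj[OF inv_perm] permutes_image[OF inv_perm]
      by (metis image_set_diff image_insert image_empty)
    then have "inv u ` (({a, b, c} - {b}) \<union> (T - {a, b, c})) = ({a, b, c} - {a}) \<union> (T - {a, b, c})"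
      by (simp only: image_Un outside[OF inv_perm])
    moreover have "({a, b, c} - {b}) \<union> (T - {a, b, c}) = T"
      "({a, b, c} - {a}) \<union> (T - {a, b, c}) = insert b (T - {a})"
      using True T by auto
    ultimately show ?thesis using stab_inv[OF u] by (auto intro: same_orbitI)
  next
    case False
    have "T = insert a (T - {a, b, c})" using T False by auto
    then have "u ` T = insert b (T - {a, b, c})" by (metis image_insert outside[OF u_perm] ua)
    also have "\<dots> = insert b (T - {a})" using T False by auto
    finally show ?thesis by (rule same_orbitI[OF u])
  qed
qed

lemma exch_if_transpose_eq:
  assumes "act (Transposition.transpose a b) x = act (Transposition.transpose a c) x"
  shows "exch x b c"
proof (cases "b = c")
  case False
  let ?u = "Transposition.transpose a b \<circ> Transposition.transpose a c"
  have "act ?u x = x"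
    using assms act_eq_act_iff[of "Transposition.transpose a c" "Transposition.transpose a b" x x]
    by simp
  then have "?u \<in> stab {c, b, a} x"
    by (simp add: stab_def permutes_compose permutes_swap_id)
  moreover have "?u c = b" by simp
  ultimately show ?thesis using exch_if_stab_triple exch_sym by blast
qed (simp add: exch_refl)

lemma same_orbit_if_exch:
  assumes exch: "\<And>a b. a \<in> W \<Longrightarrow> b \<in> W \<Longrightarrow> exch x a b"
    and "S - T \<subseteq> W" "T - S \<subseteq> W" "card S = card T"
  shows "same_orbit x S T"
  using assms(2-)
proof (induction "card (S - T)" arbitrary: S)
  case 0
  then have "S \<subseteq> T" by simp
  then have "S = T" using 0 by (simp add: card_subset_eq)
  then show ?case by (simp add: same_orbit_refl)
next
  case (Suc m)
  have "card (T - S) = card (S - T)"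
    using Suc.prems(3) by (metis Int_commute card_Diff_subset_Int finite)
  then obtain a b where a: "a \<in> S" "a \<notin> T" and b: "b \<in> T" "b \<notin> S"
    using Suc.hyps(2) by (metis Diff_iff card_eq_0_iff ex_in_conv nat.distinct(1))
  let ?S = "insert b (S - {a})"
  have "?S - T = (S - T) - {a}" using a b by auto
  then have "m = card (?S - T)" using Suc.hyps(2) a by simp
  moreover have "?S - T \<subseteq> W" "T - ?S \<subseteq> W" using Suc.prems a b by auto
  moreover have "card ?S = card T"
    using Suc.prems(3) a(1) b(2) card_Suc_Diff1[of S a] by simp
  ultimately have "same_orbit x ?S T" by (rule Suc.hyps(1))
  moreover have "exch x a b" using exch a b Suc.prems by blast
  then have "same_orbit x S ?S" using a(1) b(2) by (rule exchD)
  ultimately show ?case using same_orbit_trans by blast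
qed

lemma ex_exch_if_small_orb:
  assumes "card (orb A x) < card A"
  obtains a b where "a \<in> A" "b \<in> A" "a \<noteq> b" "exch x a b"
proof -
  obtain c where c: "c \<in> A" using assms by fastforce
  have "(\<lambda>a. act (Transposition.transpose c a) x) ` A \<subseteq> orb A x"
    using c by (auto intro: transpose_in_orb)
  then have "\<not> inj_on (\<lambda>a. act (Transposition.transpose c a) x) A"
    using assms by (metis card_image card_mono finite_orb not_le)
  then show thesis using that exch_if_transpose_eq unfolding inj_on_def by metis
qed

lemma exch_on_if_transitive_on_remove:
  assumes "exch x a b" "a \<noteq> b" "a \<in> A" "b \<in> A" and tr: "transitive_on (A - {a}) x"
    and "c \<in> A" "d \<in> A"
  shows "exch x c d"
proof -
  have "exch x a e" if e: "e \<in> A" for e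
  proof (cases "e = a")
    case False
    then obtain u where u: "u \<in> stab (A - {a}) x" "u b = e"
      using e assms transitive_onE[OF tr, of b e] by blast
    then have "u \<in> stab UNIV x" "u a = a"
      using stab_mono[of A UNIV x] by (auto simp: stab_remove)
    then show ?thesis using exch_stab[OF assms(1), of u] u(2) by simp
  qed (simp add: exch_refl)
  then show ?thesis using assms(6,7) exch_trans[OF exch_sym] by blast
qed

lemma exch_on_if_small_orb:
  assumes small: "2 * card (orb A x) < card A" and "c \<in> A" "d \<in> A"
  shows "exch x c d"
proof -
  have tr: "transitive_on A x"
    using card_le_card_orb_if_intransitive[of A x] small by linarith
  have "card (orb A x) < card A" using small by linarith
  then obtain a b where ab: "a \<in> A" "b \<in> A" "a \<noteq> b" "exch x a b" by (rule ex_exch_if_small_orb)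
  have "card (orb (A - {a}) x) < card (A - {a})"
    using small card_orb_pos[of A x] ab(1) by (simp add: card_orb_remove_transitive[OF ab(1) tr])
  then have "transitive_on (A - {a}) x"
    using card_le_card_orb_if_intransitive[of "A - {a}" x] by linarith
  then show ?thesis using exch_on_if_transitive_on_remove[OF ab(4,3,1,2)] assms(2,3) by blast
qed

lemma exch_on_UNIV_if_large_class:
  assumes tr: "transitive_on UNIV x" and large: "CARD('v) < 2 * card W"
    and W: "\<And>a b. a \<in> W \<Longrightarrow> b \<in> W \<Longrightarrow> exch x a b"
  shows "exch x c d"
proof -
  obtain w where w: "w \<in> W" using large by fastforce
  have "exch x w e" for e
  proof -
    obtain u where u: "u \<in> stab UNIV x" "u w = e" using transitive_onE[OF tr, of w e] by blast
    have "card (u ` W) = card W"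
      using inj_on_subset[OF bij_is_inj[OF stab_bij[OF u(1)]]] by (intro card_image) blast
    then have "u ` W \<inter> W \<noteq> {}"
      using large card_mono[of UNIV "u ` W \<union> W"] card_Un_disjoint[of "u ` W" W] by fastforce
    then obtain v where v: "v \<in> W" "u v \<in> W" by blast
    have "exch x (u v) (u w)" using exch_stab[OF W[OF v(1) w] u(1)] .
    then show ?thesis using exch_trans[OF W[OF w v(2)]] u(2) by simp
  qed
  then show ?thesis using exch_trans[OF exch_sym] by blast
qed

lemma same_orbit_if_transitive_on_Compl:
  assumes tr: "\<And>B. card B < k \<Longrightarrow> transitive_on (- B) x"
    and "card S = card T" "card S \<le> k"
  shows "same_orbit x S T"
  using finite[of S] assms(2,3)
proof (induction S arbitrary: T rule: finite_induct)
  case empty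
  then show ?case by (simp add: same_orbit_refl)
next
  case (insert a S)
  then obtain b T' where T: "T = insert b T'" "b \<notin> T'" by (metis card_eq_SucD card_insert_disjoint)
  have "card S = card T'" using insert.hyps insert.prems(1) T by simp
  then obtain u where u: "u \<in> stab UNIV x" "u ` S = T'"
    using insert.IH[of T'] insert.prems(2) insert.hyps by (auto simp: same_orbit_def)
  have "u a \<in> - T'"
    using u insert.hyps(2) inj_image_mem_iff[OF bij_is_inj[OF stab_bij[OF u(1)]]] by blast
  moreover have "card T' < k" using \<open>card S = card T'\<close> insert.hyps insert.prems(2) by simp
  ultimately obtain w where w: "w \<in> stab (- T') x" "w (u a) = b"
    using T(2) transitive_onE[OF tr, of T' "u a" b] by blast
  have "w ` T' = T'" using permutes_not_in[OF stab_permutes[OF w(1)]] by force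
  then have "w ` insert (u a) T' = T" using w(2) T(1) by simp
  then have "same_orbit x (insert (u a) T') T" by (rule same_orbitI[OF w(1)])
  moreover have "same_orbit x (insert a S) (insert (u a) T')"
    using u by (auto intro: same_orbitI)
  ultimately show ?case using same_orbit_trans by blast
qed

subsection \<open>Stabilisers of small index\<close>

lemma exch_off_fixed_point:
  assumes small: "2 * card (orb UNIV x) < CARD('v) * (CARD('v) - 1)"
    and v: "v \<in> fixed_points UNIV x" and "a \<noteq> v" "b \<noteq> v"
  shows "exch x a b"
proof -
  have "CARD('v) * (2 * card (orb (UNIV - {v}) x)) < CARD('v) * (CARD('v) - 1)"
    using small by (simp add: card_orb_remove_fixed_point[OF v] mult.left_commute)
  then have "2 * card (orb (UNIV - {v}) x) < card (UNIV - {v})" by (simp add: card_Diff_singleton)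
  then show ?thesis using assms(3,4) by (intro exch_on_if_small_orb[of "UNIV - {v}"]) auto
qed

lemma exch_if_not_2_transitive:
  assumes n: "5 \<le> CARD('v)" and small: "2 * card (orb UNIV x) < CARD('v) * (CARD('v) - 3)"
    and tr: "transitive_on UNIV x" and ntr: "\<not> transitive_on (UNIV - {a}) x"
  shows "exch x c d"
proof -
  obtain m where m: "CARD('v) = m + 5" using n by (metis le_Suc_ex add.commute)
  have small: "2 * card (orb UNIV x) < (m + 4) * (m + 3)"
    using small by (simp add: m algebra_simps)
  have card_orb: "card (orb (UNIV - {a}) x) = card (orb UNIV x)"
    using tr by (simp add: card_orb_remove_transitive)
  have card_remove: "card (UNIV - {a}) = m + 4" by (simp add: m)
  have "2 * card (orb (UNIV - {a}) x) < card (UNIV - {a}) * (card (UNIV - {a}) - 1)"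
    using small unfolding card_orb card_remove by (simp add: add.commute)
  then obtain b where b: "b \<in> fixed_points (UNIV - {a}) x"
    using fixed_points_nonempty_if_small_orb ntr by blast
  define W where "W = UNIV - {a} - {b}"
  have card_W: "card W = m + 3"
    using b by (simp add: W_def m fixed_points_def)
  have "(m + 4) * (2 * card (orb W x)) < (m + 4) * (m + 3)"
    using small card_orb_remove_fixed_point[OF b] by (simp add: card_orb card_remove W_def)
  then have "2 * card (orb W x) < card W" by (simp add: card_W)
  then have "exch x p q" if "p \<in> W" "q \<in> W" for p q using exch_on_if_small_orb that by blast
  then show ?thesis using exch_on_UNIV_if_large_class[OF tr, of W] by (simp add: card_W m)
qed

lemma exch_freeD: "exch_free x \<Longrightarrow> exch x a b \<Longrightarrow> a = b"
  by (simp add: exch_free_def)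

lemma exch_free_if_2_transitive:
  assumes "\<And>a. transitive_on (UNIV - {a}) x" "\<not> exch x c d"
  shows "exch_free x"
  using assms exch_on_if_transitive_on_remove[where A = UNIV] unfolding exch_free_def by blast

lemma card_orb_triple:
  assumes free: "exch_free x" and "card Z = 3"
  shows "card (orb Z x) = 6"
proof -
  have "u a = a" if u: "u \<in> stab Z x" for u a
  proof (rule ccontr)
    assume ne: "u a \<noteq> a"
    note perm = stab_permutes[OF u]
    have "a \<in> Z" using permutes_not_in[OF perm] ne by blast
    then have ua: "u a \<in> Z - {a}" using perm ne by (simp add: permutes_in_image)
    have "card (Z - {a} - {u a}) = 1" using \<open>card Z = 3\<close> \<open>a \<in> Z\<close> ua by simp
    then obtain c where "Z - {a} - {u a} = {c}" by (meson card_1_singletonE)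
    then have "Z = {a, u a, c}" using \<open>a \<in> Z\<close> ua by blast
    then have "exch x a (u a)" using exch_if_stab_triple[of u a "u a" c x] u by simp
    then show False using exch_freeD[OF free] ne by metis
  qed
  then have "stab Z x = {id}" using stab_id by (auto simp: fun_eq_iff)
  then show ?thesis using card_orb_stab[of Z x] \<open>card Z = 3\<close> by (simp add: fact_numeral)
qed

lemma transpose_collision:
  assumes small: "2 * card (orb UNIV x) < CARD('v) * (CARD('v) - 1)"
  obtains a b c d where "a \<noteq> b" "c \<noteq> d" "{a, b} \<noteq> {c, d}"
    "act (Transposition.transpose a b) x = act (Transposition.transpose c d) x"
proof -
  define img where "img e y \<longleftrightarrow>
    (\<exists>a b. e = {a, b} \<and> a \<noteq> b \<and> act (Transposition.transpose a b) x = y)" for e y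
  have "\<exists>e e' y. e \<noteq> e' \<and> img e y \<and> img e' y"
  proof (rule ccontr)
    assume "\<not> ?thesis"
    then have inj: "e = e'" if "img e y" "img e' y" for e e' y using that by blast
    have "card {e :: 'v set. card e = 2} \<le> card (orb UNIV x)"
    proof (rule card_le_if_inj_on_rel[where r = img])
      fix e :: "'v set" assume "e \<in> {e. card e = 2}"
      then obtain a b where "e = {a, b}" "a \<noteq> b" by (auto simp: card_2_iff)
      then show "\<exists>y. y \<in> orb UNIV x \<and> img e y" using transpose_in_orb unfolding img_def by blast
    qed (fact finite_orb, rule inj)
    then have "CARD('v) choose 2 \<le> card (orb UNIV x)" using n_subsets[of "UNIV :: 'v set" 2] by simp
    moreover have "2 * (CARD('v) choose 2) = CARD('v) * (CARD('v) - 1)" by (simp add: choose_two)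
    ultimately show False using small by linarith
  qed
  then show thesis using that unfolding img_def by metis
qed

lemma disjoint_transpose_collision:
  assumes free: "exch_free x" and small: "2 * card (orb UNIV x) < CARD('v) * (CARD('v) - 1)"
  obtains a b c d where "distinct [a, b, c, d]"
    "act (Transposition.transpose a b) x = act (Transposition.transpose c d) x"
proof -
  obtain a b c d where ne: "a \<noteq> b" "c \<noteq> d" "{a, b} \<noteq> {c, d}"
    and eq: "act (Transposition.transpose a b) x = act (Transposition.transpose c d) x"
    using transpose_collision[OF small] by blast
  have "{a, b} \<inter> {c, d} = {}"
  proof (rule ccontr)
    assume "{a, b} \<inter> {c, d} \<noteq> {}"
    then obtain p q r where pqr: "{a, b} = {p, q}" "{c, d} = {p, r}" by blast
    then have "act (Transposition.transpose p q) x = act (Transposition.transpose p r) x"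
      using eq by (metis doubleton_eq_iff transpose_commute)
    then show False using exch_freeD[OF free exch_if_transpose_eq] pqr ne(3) by metis
  qed
  then have "distinct [a, b, c, d]" using ne by auto
  then show thesis using eq by (rule that)
qed

lemma fixed_point_of_transpose_collision:
  assumes free: "exch_free x" and distinct: "distinct [a, b, c, d]"
    and eq: "act (Transposition.transpose a b) x = act (Transposition.transpose c d) x"
  shows "a \<in> fixed_points (- {b, c, d}) x"
proof -
  have "h a = a" if h: "h \<in> stab (- {b, c, d}) x" for h
  proof -
    have fix_bcd: "h b = b" "h c = c" "h d = d"
      using permutes_not_in[OF stab_permutes[OF h]] by simp_all
    have act_conj: "act (Transposition.transpose (h p) (h q)) x =
        act h (act (Transposition.transpose p q) x)" for p q
    proof -
      have "Transposition.transpose (h p) (h q) \<circ> h = h \<circ> Transposition.transpose p q"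
        using stab_bij[OF h] by (simp add: transpose_comp_eq bij_is_inj)
      then show ?thesis
        using h stab_bij[OF h]
        by (metis (mono_tags, lifting) act_comp bij_transpose mem_Collect_eq stab_def)
    qed
    have "act (Transposition.transpose (h a) b) x = act h (act (Transposition.transpose c d) x)"
      using act_conj[of a b] fix_bcd eq by simp
    also have "\<dots> = act (Transposition.transpose a b) x" using act_conj[of c d] fix_bcd eq by simp
    finally show "h a = a"
      using exch_freeD[OF free exch_if_transpose_eq, of b] by (simp add: transpose_commute)
  qed
  then show ?thesis using distinct by (auto simp: fixed_points_def)
qed

lemma card_eq_6_if_exch_free:
  assumes free: "exch_free x" and n: "6 \<le> CARD('v)"
    and small: "2 * card (orb UNIV x) < CARD('v) * (CARD('v) - 3)"
  shows "CARD('v) = 6"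
proof -
  obtain m where m: "CARD('v) = m + 6" using n by (metis le_Suc_ex add.commute)
  have "2 * card (orb UNIV x) < CARD('v) * (CARD('v) - 1)"
    using small by (rule less_le_trans) simp
  then obtain a b c d where distinct: "distinct [a, b, c, d]"
    and eq: "act (Transposition.transpose a b) x = act (Transposition.transpose c d) x"
    using disjoint_transpose_collision[OF free] by blast
  define Z where "Z = - {b, c, d} - {a}"
  have "card (- {b, c, d}) = m + 3"
    using distinct by (simp add: Compl_eq_Diff_UNIV card_Diff_subset m)
  moreover have "a \<in> fixed_points (- {b, c, d}) x"
    using fixed_point_of_transpose_collision[OF free distinct eq] .
  ultimately have card_Z: "card Z = m + 2"
    and "card (orb (- {b, c, d}) x) = (m + 3) * card (orb Z x)"
    by (simp_all add: Z_def card_orb_remove_fixed_point fixed_points_def)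
  moreover have "card (orb (- {b, c, d}) x) \<le> card (orb UNIV x)"
    by (intro card_mono finite_orb orb_mono) simp
  ultimately have "(m + 3) * (2 * card (orb Z x)) < (m + 3) * (m + 6)"
    using small by (simp add: m algebra_simps)
  then have small_Z: "2 * card (orb Z x) < m + 6" by (simp only: nat_mult_less_cancel_disj)
  have "card Z \<le> card (orb Z x)"
    using ex_exch_if_small_orb[of Z x] exch_freeD[OF free] by (metis not_le)
  moreover have "m \<noteq> 1" using card_orb_triple[OF free, of Z] small_Z card_Z by auto
  ultimately show ?thesis using small_Z card_Z m by simp
qed

text \<open>For six points the exceptional subgroup \<open>PGL(2, 5)\<close> of index 6 survives the counting
  arguments; it exchanges no two points, but it is 3-transitive.\<close>

lemma transitive_on_remove_pair:
  assumes n: "CARD('v) = 6" and small: "card (orb UNIV x) \<le> 8" and free: "exch_free x"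
    and tr: "transitive_on UNIV x" and tr_remove: "transitive_on (UNIV - {a}) x" and "a \<noteq> b"
  shows "transitive_on (UNIV - {a} - {b}) x"
proof (rule transitive_on_if_large_point_orbs)
  let ?W = "UNIV - {a} - {b}"
  fix c assume c: "c \<in> ?W"
  have card_W: "card ?W = 4" using \<open>a \<noteq> b\<close> n by simp
  have "card (orb ?W x) = card (orb UNIV x)"
    using \<open>a \<noteq> b\<close> by (simp add: card_orb_remove_transitive tr tr_remove)
  moreover have "card (orb (?W - {c}) x) = 6"
    by (rule card_orb_triple[OF free]) (use c card_W in simp)
  ultimately have "24 = card (orb UNIV x) * card (point_orb ?W x c)"
    using card_orb_remove[OF c, of x] card_W by simp
  also have "\<dots> \<le> 8 * card (point_orb ?W x c)" using small by simp
  finally show "card ?W < 2 * card (point_orb ?W x c)" using card_W by simp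
qed

lemma same_orbit_if_small_orb:
  assumes n: "6 \<le> CARD('v)" and small: "2 * card (orb UNIV x) < CARD('v) * (CARD('v) - 3)"
    and tr: "transitive_on UNIV x" and eq: "card S = card T"
  shows "same_orbit x S T"
proof (cases "\<forall>a b. exch x a b")
  case True
  then show ?thesis using eq by (intro same_orbit_if_exch[of UNIV]) auto
next
  case False
  have tr_remove: "transitive_on (UNIV - {a}) x" for a
    using exch_if_not_2_transitive[OF _ small tr] n False by force
  then have free: "exch_free x" using exch_free_if_2_transitive False by blast
  have card_6: "CARD('v) = 6" using card_eq_6_if_exch_free[OF free n small] .
  have "transitive_on (- B) x" if B: "card B < 3" for B
  proof -
    consider "card B = 0" | "card B = 1" | "card B = 2" using B by linarith
    then show ?thesis
    proof cases
      case 3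
      then obtain a b where "B = {a, b}" "a \<noteq> b" by (meson card_2_iff)
      moreover have "- {a, b} = UNIV - {a} - {b}" by auto
      ultimately show ?thesis
        using transitive_on_remove_pair[OF card_6 _ free tr tr_remove] small card_6 by simp
    qed (use tr tr_remove in \<open>auto simp: card_1_singleton_iff Compl_eq_Diff_UNIV\<close>)
  qed
  then have small_sets: "same_orbit x S T" if "card S = card T" "card S \<le> 3" for S T
    using same_orbit_if_transitive_on_Compl that by blast
  show ?thesis
  proof (cases "card S \<le> 3")
    case False
    then have "same_orbit x (- S) (- T)"
      using eq card_6 by (intro small_sets) (simp_all add: Compl_eq_Diff_UNIV card_Diff_subset)
    then show ?thesis by (rule same_orbit_ComplD)
  qed (use small_sets eq in blast)
qed

lemma act_stab_conj:
  assumes \<pi>: "bij \<pi>" and u: "u \<in> stab UNIV (act \<pi> x)"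
  shows "inv \<pi> \<circ> (u \<circ> \<pi>) \<in> stab UNIV x"
proof -
  have "act (u \<circ> \<pi>) x = act \<pi> x" using u \<pi> by (simp add: act_comp stab_bij stab_def permutes_bij)
  then have "act (inv \<pi> \<circ> (u \<circ> \<pi>)) x = x"
    using \<pi> stab_bij[OF u] act_eq_act_iff[of "u \<circ> \<pi>" \<pi> x x] act_eq_act_iff[of \<pi> \<pi> x x]
    by (simp add: bij_comp)
  then show ?thesis
    unfolding stab_def using \<pi> stab_bij[OF u]
    by (intro CollectI conjI bij_imp_permutes bij_comp bij_imp_bij_inv) simp_all
qed

lemma transitive_on_if_act:
  assumes \<pi>: "bij \<pi>" and tr: "transitive_on UNIV (act \<pi> x)"
  shows "transitive_on UNIV x"
proof (rule transitive_onI)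
  fix a b
  obtain u where u: "u \<in> stab UNIV (act \<pi> x)" "u (\<pi> a) = \<pi> b"
    using transitive_onE[OF tr, of "\<pi> a" "\<pi> b"] by blast
  have "(inv \<pi> \<circ> (u \<circ> \<pi>)) a = b" using u(2) \<pi> by (simp add: bij_is_inj)
  then show "\<exists>u\<in>stab UNIV x. u a = b" using act_stab_conj[OF \<pi> u(1)] by blast
qed

lemma fixed_points_act:
  assumes \<pi>: "bij \<pi>" and v: "v \<in> fixed_points UNIV x"
  shows "\<pi> v \<in> fixed_points UNIV (act \<pi> x)"
proof -
  have "u (\<pi> v) = \<pi> v" if "u \<in> stab UNIV (act \<pi> x)" for u
  proof -
    have "(inv \<pi> \<circ> (u \<circ> \<pi>)) v = v"
      using act_stab_conj[OF \<pi> that] v by (simp only: fixed_points_def mem_Collect_eq)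
    then show ?thesis using \<pi> by (metis bij_inv_eq_iff comp_apply)
  qed
  then show ?thesis by (simp add: fixed_points_def)
qed

lemma transitive_small_orb_if_ex_intransitive:
  assumes fin: "finite C" and closed: "\<And>z \<pi>. z \<in> C \<Longrightarrow> bij \<pi> \<Longrightarrow> act \<pi> z \<in> C"
    and small: "2 * card C < CARD('v) * (CARD('v) - 1)" and n: "3 \<le> CARD('v)"
    and x: "x \<in> C" "transitive_on UNIV x" and y: "y \<in> C" "\<not> transitive_on UNIV y"
  shows "2 * card (orb UNIV x) < CARD('v) * (CARD('v) - 3)"
proof -
  have "orb UNIV x \<inter> orb UNIV y = {}"
  proof (rule ccontr)
    assume "orb UNIV x \<inter> orb UNIV y \<noteq> {}"
    then obtain z where z: "z \<in> orb UNIV x" "z \<in> orb UNIV y" by blast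
    obtain \<pi> where \<pi>: "\<pi> permutes UNIV" "z = act \<pi> x" using z(1) by (auto simp: orb_def)
    obtain \<rho> where \<rho>: "\<rho> permutes UNIV" "z = act \<rho> y" using z(2) by (auto simp: orb_def)
    note bij = permutes_bij[OF \<pi>(1)] permutes_bij[OF \<rho>(1)]
    have "act \<rho> y = act \<pi> x" using \<pi>(2) \<rho>(2) by simp
    then have "act (inv \<pi> \<circ> \<rho>) y = x" using act_eq_act_iff[OF bij(2,1)] by blast
    then show False
      using transitive_on_if_act[of "inv \<pi> \<circ> \<rho>" y] bij x(2) y(2)
      by (simp add: bij_comp bij_imp_bij_inv)
  qed
  then have "card (orb UNIV x) + card (orb UNIV y) = card (orb UNIV x \<union> orb UNIV y)"
    by (simp add: card_Un_disjoint finite_orb)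
  also have "\<dots> \<le> card C"
    by (intro card_mono fin Un_least orb_subset_if_closed closed x(1) y(1))
  finally have "2 * card (orb UNIV x) + 2 * CARD('v) < CARD('v) * (CARD('v) - 1)"
    using card_le_card_orb_if_intransitive[OF y(2)] small by linarith
  also have "\<dots> = CARD('v) * (CARD('v) - 3) + 2 * CARD('v)"
    using n by (simp add: algebra_simps diff_mult_distrib2)
  finally show ?thesis by simp
qed

end

subsection \<open>Families of labelings\<close>

definition labelings :: "('v::finite \<Rightarrow> nat) set" where
  "labelings = {\<sigma>. bij_betw \<sigma> UNIV {1..CARD('v)}}"

definition facet :: "'v::finite set \<Rightarrow> ('v \<Rightarrow> nat) set" where
  "facet S = {\<sigma> \<in> labelings. \<sigma> ` S = {1..card S}}"

definition separates_facets :: "('v::finite \<Rightarrow> nat) set set \<Rightarrow> bool" where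
  "separates_facets F \<longleftrightarrow> (\<forall>S. \<forall>\<rho>\<in>labelings - facet S. \<exists>X\<in>F. \<rho> \<in> X \<and> X \<inter> facet S = {})"

definition relabel :: "('v \<Rightarrow> 'v) \<Rightarrow> ('v \<Rightarrow> 'b) set \<Rightarrow> ('v \<Rightarrow> 'b) set" where
  "relabel \<pi> X = {\<sigma>. \<sigma> \<circ> \<pi> \<in> X}"

definition thresholds :: "('v \<Rightarrow> nat) set \<Rightarrow> 'v \<Rightarrow> nat set" where
  "thresholds X v = {Min ((\<lambda>\<sigma>. \<sigma> v) ` X) - 1, Max ((\<lambda>\<sigma>. \<sigma> v) ` X)}"

lemma finite_labelings: "finite (labelings :: ('v::finite \<Rightarrow> nat) set)"
proof (rule finite_subset)
  show "(labelings :: ('v \<Rightarrow> nat) set) \<subseteq> (\<Pi>\<^sub>E v\<in>UNIV. {1..CARD('v)})"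
    by (auto simp: labelings_def bij_betw_def PiE_def)
qed (simp add: finite_PiE)

lemma labeling_inj: "\<sigma> \<in> labelings \<Longrightarrow> inj \<sigma>"
  by (simp add: labelings_def bij_betw_def)

lemma labeling_range: "\<sigma> \<in> labelings \<Longrightarrow> range \<sigma> = {1..CARD('v)}" for \<sigma> :: "'v::finite \<Rightarrow> nat"
  by (simp add: labelings_def bij_betw_def)

lemma labeling_pos: "\<sigma> \<in> labelings \<Longrightarrow> 0 < \<sigma> v"
  using labeling_range[of \<sigma>] by (metis atLeastAtMost_iff less_eq_Suc_le One_nat_def rangeI)

lemma comp_labeling_iff:
  fixes \<pi> :: "'v::finite \<Rightarrow> 'v"
  assumes "bij \<pi>"
  shows "\<sigma> \<circ> \<pi> \<in> labelings \<longleftrightarrow> \<sigma> \<in> labelings"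
  using bij_betw_comp_iff[OF assms, of \<sigma> "{1..CARD('v)}"] by (simp add: labelings_def)

lemma image_vimage_labeling:
  fixes \<sigma> :: "'v::finite \<Rightarrow> nat"
  assumes "\<sigma> \<in> labelings" "T \<subseteq> {1..CARD('v)}"
  shows "\<sigma> ` (\<sigma> -` T) = T" and "card (\<sigma> -` T) = card T"
  using assms by (auto simp: labeling_range labeling_inj card_vimage_inj)

lemma card_vimage_Icc_card:
  fixes \<sigma> :: "'v::finite \<Rightarrow> nat" and S :: "'v set"
  assumes "\<sigma> \<in> labelings"
  shows "card (\<sigma> -` {1..card S}) = card S"
  using image_vimage_labeling(2)[OF assms, of "{1..card S}"] by (simp add: card_mono)

lemma ex_labeling: "\<exists>\<sigma>. \<sigma> \<in> (labelings :: ('v::finite \<Rightarrow> nat) set)"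
  using finite_same_card_bij[of "UNIV :: 'v set" "{1..CARD('v)}"] by (simp add: labelings_def)

lemma ex_labeling_image:
  assumes "T \<subseteq> {1..CARD('v::finite)}"
  obtains \<sigma> :: "'v::finite \<Rightarrow> nat" and S where "\<sigma> \<in> labelings" "card S = card T" "\<sigma> ` S = T"
  using ex_labeling image_vimage_labeling[OF _ assms] by metis

interpretation relabel: sym_action relabel
  by unfold_locales (simp_all add: relabel_def comp_assoc)

lemma comp_stab_iff: "u \<in> relabel.stab A X \<Longrightarrow> \<sigma> \<circ> u \<in> X \<longleftrightarrow> \<sigma> \<in> X"
  unfolding relabel.stab_def relabel_def by blast

lemma thresholds_relabel:
  assumes "bij \<pi>"
  shows "thresholds (relabel \<pi> X) (\<pi> v) = thresholds X v"
proof -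
  have "(\<lambda>\<sigma>. \<sigma> (\<pi> v)) ` relabel \<pi> X = (\<lambda>\<sigma>. \<sigma> v) ` X"
  proof (intro equalityI image_subsetI)
    fix \<sigma> assume "\<sigma> \<in> relabel \<pi> X"
    then show "\<sigma> (\<pi> v) \<in> (\<lambda>\<sigma>. \<sigma> v) ` X"
      by (intro image_eqI[of _ _ "\<sigma> \<circ> \<pi>"]) (simp_all add: relabel_def)
  next
    fix \<sigma> assume "\<sigma> \<in> X"
    then show "\<sigma> v \<in> (\<lambda>\<sigma>. \<sigma> (\<pi> v)) ` relabel \<pi> X"
      using bij_is_inj[OF assms]
      by (intro image_eqI[of _ _ "\<sigma> \<circ> inv \<pi>"]) (simp_all add: relabel_def comp_assoc)
  qed
  then show ?thesis by (simp add: thresholds_def)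
qed

context
  fixes X :: "('v::finite \<Rightarrow> nat) set" and S :: "'v set"
  assumes subset: "X \<subseteq> labelings" and avoids: "X \<inter> facet S = {}"
begin

lemma not_same_orbit_vimage:
  assumes \<sigma>: "\<sigma> \<in> X"
  shows "\<not> relabel.same_orbit X S (\<sigma> -` {1..card S})"
proof
  assume "relabel.same_orbit X S (\<sigma> -` {1..card S})"
  then obtain u where u: "u \<in> relabel.stab UNIV X" "u ` S = \<sigma> -` {1..card S}"
    by (auto simp: relabel.same_orbit_def)
  have "(\<sigma> \<circ> u) ` S = \<sigma> ` (\<sigma> -` {1..card S})" using u(2) by (simp only: image_comp[symmetric])
  also have "\<dots> = {1..card S}"
    using \<sigma> subset by (intro image_vimage_labeling) (auto simp: card_mono)
  finally have "(\<sigma> \<circ> u) ` S = {1..card S}" .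
  moreover have "\<sigma> \<circ> u \<in> X" using \<sigma> comp_stab_iff[OF u(1)] by simp
  ultimately have "\<sigma> \<circ> u \<in> X \<inter> facet S" using subset unfolding facet_def by blast
  then show False using avoids by blast
qed

lemma intransitive_if_avoids_small_orb:
  assumes "X \<noteq> {}" "6 \<le> CARD('v)" "2 * card (relabel.orb UNIV X) < CARD('v) * (CARD('v) - 3)"
  shows "\<not> relabel.transitive_on UNIV X"
proof
  assume tr: "relabel.transitive_on UNIV X"
  obtain \<sigma> where \<sigma>: "\<sigma> \<in> X" using assms(1) by blast
  then have "card S = card (\<sigma> -` {1..card S})"
    using subset by (intro card_vimage_Icc_card[symmetric]) auto
  then have "relabel.same_orbit X S (\<sigma> -` {1..card S})"
    by (rule relabel.same_orbit_if_small_orb[OF assms(2,3) tr])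
  then show False using not_same_orbit_vimage[OF \<sigma>] by blast
qed

lemma intransitive_if_avoids_singleton:
  assumes "X \<noteq> {}" "card S = 1"
  shows "\<not> relabel.transitive_on UNIV X"
proof
  assume tr: "relabel.transitive_on UNIV X"
  obtain \<sigma> where \<sigma>: "\<sigma> \<in> X" using assms(1) by blast
  obtain w w' where w: "S = {w}" "\<sigma> -` {1..card S} = {w'}"
    using card_vimage_Icc_card[of \<sigma> S] \<sigma> subset assms(2) by (metis card_1_singletonE subsetD)
  obtain u where "u \<in> relabel.stab UNIV X" "u w = w'"
    using relabel.transitive_onE[OF tr, of w w'] by blast
  then have "relabel.same_orbit X S (\<sigma> -` {1..card S})"
    using w by (auto intro: relabel.same_orbitI)
  then show False using not_same_orbit_vimage[OF \<sigma>] by blast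
qed

lemma mem_iff_card_less_label:
  assumes exch: "\<And>a b. a \<noteq> v \<Longrightarrow> b \<noteq> v \<Longrightarrow> relabel.exch X a b" and \<sigma>: "\<sigma> \<in> X"
  shows "v \<in> S \<longleftrightarrow> card S < \<sigma> v"
proof (rule ccontr)
  let ?T = "\<sigma> -` {1..card S}"
  assume "(v \<in> S) \<noteq> (card S < \<sigma> v)"
  moreover have "0 < \<sigma> v" using \<sigma> subset by (auto intro: labeling_pos)
  ultimately have "v \<in> S \<longleftrightarrow> v \<in> ?T" by auto
  then have "relabel.same_orbit X S ?T"
    using exch card_vimage_Icc_card[of \<sigma> S] \<sigma> subset
    by (intro relabel.same_orbit_if_exch[of "- {v}"]) auto
  then show False using not_same_orbit_vimage[OF \<sigma>] by blast
qed

lemma card_mem_thresholds: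
  assumes exch: "\<And>a b. a \<noteq> v \<Longrightarrow> b \<noteq> v \<Longrightarrow> relabel.exch X a b"
    and \<rho>: "\<rho> \<in> X" "\<rho> ` S = insert (Suc (card S)) {1..<card S}"
  shows "card S \<in> thresholds X v"
proof -
  let ?V = "(\<lambda>\<sigma>. \<sigma> v) ` X"
  have fin: "finite ?V" using finite_subset[OF subset finite_labelings] by simp
  have mem_S: "v \<in> S \<longleftrightarrow> card S < i" if "i \<in> ?V" for i
    using mem_iff_card_less_label[OF exch] that by blast
  have \<rho>v: "\<rho> v \<in> ?V" using \<rho>(1) by blast
  have "\<rho> \<in> labelings" using \<rho>(1) subset by blast
  then have mem_image: "v \<in> S \<longleftrightarrow> \<rho> v \<in> insert (Suc (card S)) {1..<card S}"
    using \<rho>(2) by (metis inj_image_mem_iff labeling_inj)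
  show ?thesis
  proof (cases "v \<in> S")
    case True
    then have "\<rho> v = Suc (card S)" using mem_S[OF \<rho>v] mem_image by auto
    moreover have "Suc (card S) \<le> i" if "i \<in> ?V" for i using True mem_S[OF that] by simp
    ultimately have "Min ?V = Suc (card S)" using \<rho>v by (intro Min_eqI[OF fin]) auto
    then show ?thesis by (simp add: thresholds_def)
  next
    case False
    then have "\<rho> v = card S"
      using mem_S[OF \<rho>v] mem_image labeling_pos[OF \<open>\<rho> \<in> labelings\<close>, of v] by auto
    moreover have "i \<le> card S" if "i \<in> ?V" for i using False mem_S[OF that] by simp
    ultimately have "Max ?V = card S" using \<rho>v by (intro Max_eqI[OF fin]) auto
    then show ?thesis by (simp add: thresholds_def)
  qed
qed

lemma ex_fixed_point_threshold:
  assumes small: "2 * card (relabel.orb UNIV X) < CARD('v) * (CARD('v) - 1)"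
    and ntr: "\<not> relabel.transitive_on UNIV X"
    and \<rho>: "\<rho> \<in> X" "\<rho> ` S = insert (Suc (card S)) {1..<card S}"
  shows "\<exists>v\<in>relabel.fixed_points UNIV X. card S \<in> thresholds X v"
proof -
  obtain v where v: "v \<in> relabel.fixed_points UNIV X"
    using relabel.fixed_points_nonempty_if_small_orb[OF small ntr] by blast
  then show ?thesis
    using card_mem_thresholds[OF relabel.exch_off_fixed_point[OF small v] \<rho>] by blast
qed

end

lemma separates_facets_at:
  fixes F :: "('v::finite \<Rightarrow> nat) set set"
  assumes separates: "separates_facets F" and k: "k \<in> {1..<CARD('v)}"
  obtains X \<rho> S where "X \<in> F" "\<rho> \<in> X" "card S = k" "X \<inter> facet S = {}"
    "\<rho> ` S = insert (Suc (card S)) {1..<card S}"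
proof -
  have "insert (Suc k) {1..<k} \<subseteq> {1..CARD('v)}" "card (insert (Suc k) {1..<k}) = k"
    using k by auto
  then obtain \<rho> :: "'v \<Rightarrow> nat" and S
    where \<rho>: "\<rho> \<in> labelings" "card S = k" "\<rho> ` S = insert (Suc k) {1..<k}"
    using ex_labeling_image by metis
  then have "Suc k \<in> \<rho> ` S - {1..card S}" by simp
  then have "\<rho> \<notin> facet S" unfolding facet_def by blast
  then obtain X where "X \<in> F" "\<rho> \<in> X" "X \<inter> facet S = {}"
    using separates \<rho>(1) unfolding separates_facets_def by blast
  then show thesis using that \<rho>(2,3) by simp
qed

lemma ex_threshold_at_any_point:
  assumes closed: "\<And>X \<pi>. X \<in> F \<Longrightarrow> bij \<pi> \<Longrightarrow> relabel \<pi> X \<in> F"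
    and X: "X \<in> F" "w \<in> relabel.fixed_points UNIV X" "k \<in> thresholds X w"
  shows "\<exists>X\<in>F. v \<in> relabel.fixed_points UNIV X \<and> k \<in> thresholds X v"
proof (intro bexI conjI)
  let ?\<pi> = "Transposition.transpose w v"
  show "relabel ?\<pi> X \<in> F" using closed X(1) by simp
  show "v \<in> relabel.fixed_points UNIV (relabel ?\<pi> X)"
    using relabel.fixed_points_act[OF bij_transpose X(2), of w v] by simp
  show "k \<in> thresholds (relabel ?\<pi> X) v"
    using thresholds_relabel[of ?\<pi> X w] X(3) by simp
qed

lemma card_family_if_thresholds_cover:
  fixes F :: "('v::finite \<Rightarrow> nat) set set"
  assumes fin: "finite F"
    and unique: "\<And>X. X \<in> F \<Longrightarrow> card (relabel.fixed_points UNIV X) \<le> 1"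
    and cover: "\<And>k v. k \<in> {1..<CARD('v)} \<Longrightarrow>
      \<exists>X\<in>F. v \<in> relabel.fixed_points UNIV X \<and> k \<in> thresholds X v"
  shows "CARD('v) * (CARD('v) - 1) \<le> 2 * card F"
proof -
  define pairs where "pairs X = (SIGMA v:relabel.fixed_points UNIV X. thresholds X v)"
    for X :: "('v \<Rightarrow> nat) set"
  have "card (pairs X) \<le> 2" if "X \<in> F" for X
  proof -
    have "card (pairs X) = (\<Sum>v\<in>relabel.fixed_points UNIV X. card (thresholds X v))"
      unfolding pairs_def by (rule card_SigmaI) (simp_all add: thresholds_def)
    also have "\<dots> \<le> card (relabel.fixed_points UNIV X) * 2"
      using sum_bounded_above[of "relabel.fixed_points UNIV X" "\<lambda>v. card (thresholds X v)" 2]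
      by (simp add: thresholds_def card_insert_if)
    finally show ?thesis using unique[OF that] by simp
  qed
  then have le: "(\<Sum>X\<in>F. card (pairs X)) \<le> card F * 2"
    using sum_bounded_above[of F "\<lambda>X. card (pairs X)" 2] by simp
  have "card ((UNIV :: 'v set) \<times> {1..<CARD('v)}) \<le> card (\<Union>X\<in>F. pairs X)"
    using cover fin by (intro card_mono) (auto simp: pairs_def thresholds_def)
  also have "\<dots> \<le> (\<Sum>X\<in>F. card (pairs X))" by (rule card_UN_le[OF fin])
  finally show ?thesis using le by simp
qed

theorem card_separating_family:
  fixes F :: "('v::finite \<Rightarrow> nat) set set"
  assumes n: "6 \<le> CARD('v)" and F: "F \<subseteq> Pow labelings"
    and closed: "\<And>X \<pi>. X \<in> F \<Longrightarrow> bij \<pi> \<Longrightarrow> relabel \<pi> X \<in> F"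
    and separates: "separates_facets F"
  shows "CARD('v) * (CARD('v) - 1) \<le> 2 * card F"
proof (rule ccontr)
  let ?n = "CARD('v)"
  assume "\<not> ?n * (?n - 1) \<le> 2 * card F"
  then have less: "2 * card F < ?n * (?n - 1)" by simp
  have fin: "finite F" using F finite_labelings finite_subset by blast
  have small: "2 * card (relabel.orb UNIV X) < ?n * (?n - 1)" if "X \<in> F" for X
    using card_mono[OF fin relabel.orb_subset_if_closed[OF closed that, of UNIV]] less by linarith
  have "1 \<in> {1..<?n}" using n by simp
  then obtain Y \<rho> S where Y: "Y \<in> F" "\<rho> \<in> Y" "card S = 1" "Y \<inter> facet S = {}"
    using separates_facets_at[OF separates] by metis
  then have ntr: "\<not> relabel.transitive_on UNIV Y"
    using F by (intro intransitive_if_avoids_singleton) auto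
  have intransitive: "\<not> relabel.transitive_on UNIV X"
    if X: "X \<in> F" "X \<noteq> {}" "X \<inter> facet S = {}" for X S
  proof
    assume tr: "relabel.transitive_on UNIV X"
    have "2 * card (relabel.orb UNIV X) < ?n * (?n - 3)"
      using relabel.transitive_small_orb_if_ex_intransitive[OF fin closed less _ X(1) tr Y(1) ntr] n
      by simp
    then show False using intransitive_if_avoids_small_orb[OF _ X(3,2) n] F X(1) tr by blast
  qed
  have "\<exists>X\<in>F. v \<in> relabel.fixed_points UNIV X \<and> k \<in> thresholds X v" if k: "k \<in> {1..<?n}" for k v
  proof -
    obtain X \<rho> S where X: "X \<in> F" "\<rho> \<in> X" "card S = k" "X \<inter> facet S = {}"
      "\<rho> ` S = insert (Suc (card S)) {1..<card S}"
      using separates_facets_at[OF separates k] by metis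
    then have "X \<subseteq> labelings" "\<not> relabel.transitive_on UNIV X" using F intransitive by blast+
    then obtain w where "w \<in> relabel.fixed_points UNIV X" "card S \<in> thresholds X w"
      using ex_fixed_point_threshold[OF _ X(4) small[OF X(1)] _ X(2,5)] by blast
    then show ?thesis using ex_threshold_at_any_point[OF closed X(1)] X(3) by blast
  qed
  moreover have "card (relabel.fixed_points UNIV X) \<le> 1" if "X \<in> F" for X
    using small[OF that] by (intro relabel.card_fixed_points_le_1) simp
  ultimately show False using card_family_if_thresholds_cover[OF fin] less by fastforce
qed

subsection \<open>Extensions of the permutahedron\<close>

lemma sum_Icc_card_less:
  fixes A :: "nat set"
  assumes fin: "finite A" and pos: "0 \<notin> A" and ne: "A \<noteq> {1..card A}"
  shows "\<Sum>{1..card A} < \<Sum>A"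
proof -
  have "\<not> A \<subseteq> {1..card A}" "\<not> {1..card A} \<subseteq> A"
    using ne fin card_subset_eq[of "{1..card A}" A] card_subset_eq[of A "{1..card A}"] by auto
  then obtain a b where a: "a \<in> {1..card A}" "a \<notin> A" and b: "b \<in> A" "b \<notin> {1..card A}" by blast
  have "a < b" using a(1) b pos by (cases b) auto
  define B where "B = insert a (A - {b})"
  have "0 \<notin> B" "finite B" "card B = card A"
    using a b fin pos by (auto simp: B_def card_Suc_Diff1)
  then have "\<Sum>{0..<Suc (card A)} \<le> \<Sum>B" using card_sum_le_nat_sum[of "insert 0 B"] by simp
  moreover have "{0..<Suc (card A)} = insert 0 {1..card A}" by auto
  then have "\<Sum>{0..<Suc (card A)} = \<Sum>{1..card A}" by simp
  moreover have "\<Sum>B + b = \<Sum>A + a" using a b fin by (simp add: B_def sum.remove)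
  ultimately show ?thesis using \<open>a < b\<close> by linarith
qed

definition vertex :: "('v::finite \<Rightarrow> nat) \<Rightarrow> real ^ 'v" where
  "vertex \<sigma> = (\<chi> v. real (\<sigma> v))"

definition component_support ::
  "(real ^ 'v::finite \<Rightarrow> real ^ 'd::finite) \<Rightarrow> 'd \<Rightarrow> ('v \<Rightarrow> nat) set" where
  "component_support s j = {\<sigma> \<in> labelings. s (vertex \<sigma>) $ j \<noteq> 0}"

lemma permutahedron_vertices_eq: "permutahedron_vertices = vertex ` labelings"
  by (auto simp: permutahedron_vertices_def vertex_def labelings_def)

lemma linear_coordinate_sum: "linear (\<lambda>x :: real ^ 'v::finite. \<Sum>v\<in>S. x $ v)"
  by (rule linearI) (simp_all add: sum.distrib sum_distrib_left)

lemma coordinate_sum_vertex: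
  assumes "\<sigma> \<in> labelings"
  shows "(\<Sum>v\<in>S. vertex \<sigma> $ v) = real (\<Sum>(\<sigma> ` S))"
proof -
  have "inj_on \<sigma> S" using labeling_inj[OF assms] by (rule inj_on_subset) simp
  then show ?thesis by (simp add: vertex_def sum.reindex)
qed

lemma coordinate_sum_vertex_on_facet:
  "\<sigma> \<in> facet S \<Longrightarrow> (\<Sum>v\<in>S. vertex \<sigma> $ v) = real (\<Sum>{1..card S})"
  by (simp add: facet_def coordinate_sum_vertex)

lemma coordinate_sum_vertex_off_facet:
  assumes "\<sigma> \<in> labelings - facet S"
  shows "real (\<Sum>{1..card S}) < (\<Sum>v\<in>S. vertex \<sigma> $ v)"
proof -
  have \<sigma>: "\<sigma> \<in> labelings" "\<sigma> ` S \<noteq> {1..card S}" using assms by (auto simp: facet_def)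
  have "card (\<sigma> ` S) = card S"
    using inj_on_subset[OF labeling_inj[OF \<sigma>(1)]] by (intro card_image) blast
  moreover have "0 \<notin> \<sigma> ` S" using labeling_pos[OF \<sigma>(1)] by (metis imageE less_irrefl)
  ultimately have "\<Sum>{1..card S} < \<Sum>(\<sigma> ` S)" using sum_Icc_card_less[of "\<sigma> ` S"] \<sigma>(2) by simp
  then show ?thesis unfolding coordinate_sum_vertex[OF \<sigma>(1)] by (rule of_nat_less_iff[THEN iffD2])
qed

lemma permutahedron_facet_inequality:
  fixes x :: "real ^ 'v::finite"
  assumes "x \<in> permutahedron"
  shows "real (\<Sum>{1..card S}) \<le> (\<Sum>v\<in>S. x $ v)"
proof -
  let ?H = "(\<lambda>x :: real ^ 'v. \<Sum>v\<in>S. x $ v) -` {real (\<Sum>{1..card S})..}"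
  have "permutahedron \<subseteq> ?H"
    unfolding permutahedron_def
  proof (rule hull_minimal)
    show "convex ?H" by (intro convex_linear_vimage linear_coordinate_sum convex_real_interval)
    show "permutahedron_vertices \<subseteq> ?H"
      unfolding permutahedron_vertices_eq
    proof (rule image_subsetI)
      fix \<sigma> :: "'v \<Rightarrow> nat" assume "\<sigma> \<in> labelings"
      then show "vertex \<sigma> \<in> ?H"
        using coordinate_sum_vertex_on_facet[of \<sigma> S] coordinate_sum_vertex_off_facet[of \<sigma> S]
        by (cases "\<sigma> \<in> facet S") auto
    qed
  qed
  then show ?thesis using assms by auto
qed

lemma facet_nonempty: "facet (S :: 'v::finite set) \<noteq> {}"
proof -
  obtain \<sigma> :: "'v \<Rightarrow> nat" where \<sigma>: "\<sigma> \<in> labelings" using ex_labeling by blast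
  have Icc: "{1..card S} \<subseteq> {1..CARD('v)}" by (simp add: card_mono)
  obtain \<pi> where \<pi>: "\<pi> permutes UNIV" "\<pi> ` S = \<sigma> -` {1..card S}"
    using ex_permutes_image[of UNIV S "\<sigma> -` {1..card S}"] image_vimage_labeling(2)[OF \<sigma> Icc] by auto
  have "(\<sigma> \<circ> \<pi>) ` S = {1..card S}"
    using \<pi>(2) image_vimage_labeling(1)[OF \<sigma> Icc] by (simp only: image_comp[symmetric])
  then have "\<sigma> \<circ> \<pi> \<in> facet S"
    using \<sigma> comp_labeling_iff[OF permutes_bij[OF \<pi>(1)]] unfolding facet_def by blast
  then show ?thesis by blast
qed

lemma nonneg_extend_beyond:
  fixes y z :: "real ^ 'd::finite"
  assumes A: "affine A" "y \<in> A" "z \<in> A" and nonneg: "\<And>j. 0 \<le> y $ j" "\<And>j. 0 \<le> z $ j"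
    and support: "\<And>j. z $ j \<noteq> 0 \<Longrightarrow> y $ j \<noteq> 0"
  obtains \<epsilon> where "0 < \<epsilon>" "(1 + \<epsilon>) *\<^sub>R y + (- \<epsilon>) *\<^sub>R z \<in> A"
    "\<And>j. 0 \<le> ((1 + \<epsilon>) *\<^sub>R y + (- \<epsilon>) *\<^sub>R z) $ j"
proof -
  define r where "r j = (if z $ j = 0 then 1 else y $ j / z $ j)" for j
  define \<epsilon> where "\<epsilon> = Min (range r)"
  have "0 < r j" for j using nonneg[of j] support[of j] by (auto simp: r_def less_le)
  then have pos: "0 < \<epsilon>" by (simp add: \<epsilon>_def)
  have "0 \<le> ((1 + \<epsilon>) *\<^sub>R y + (- \<epsilon>) *\<^sub>R z) $ j" for j
  proof -
    have "\<epsilon> \<le> r j" by (simp add: \<epsilon>_def)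
    then have "\<epsilon> * z $ j \<le> y $ j"
      using nonneg[of j] by (auto simp: r_def less_le pos_le_divide_eq split: if_splits)
    moreover have "0 \<le> \<epsilon> * y $ j" using pos nonneg by simp
    ultimately show ?thesis by (simp add: algebra_simps)
  qed
  moreover have "(1 + \<epsilon>) *\<^sub>R y + (- \<epsilon>) *\<^sub>R z \<in> A" using A by (intro mem_affine) auto
  ultimately show thesis using that pos by blast
qed

text \<open>Otherwise one could move from the barycentre of \<open>Y\<close> slightly away from \<open>z\<close> inside \<open>Q\<close>,
  and \<open>h\<close> would drop below \<open>c\<close>.\<close>

lemma ex_coordinate_vanishing_on_face:
  fixes Q :: "(real ^ 'd::finite) set" and h :: "real ^ 'd \<Rightarrow> real"
  assumes A: "affine A" and Q: "Q = A \<inter> {y. \<forall>j. 0 \<le> y $ j}"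
    and h: "linear h" "\<And>y. y \<in> Q \<Longrightarrow> c \<le> h y"
    and Y: "finite Y" "Y \<noteq> {}" "Y \<subseteq> Q" "\<And>y. y \<in> Y \<Longrightarrow> h y = c"
    and z: "z \<in> Q" "c < h z"
  shows "\<exists>j. z $ j \<noteq> 0 \<and> (\<forall>y\<in>Y. y $ j = 0)"
proof (rule ccontr)
  assume contra: "\<not> ?thesis"
  have card_pos: "0 < card Y" using Y(1,2) by (simp add: card_gt_0_iff)
  have nonneg: "0 \<le> y $ j" if "y \<in> Q" for y j using that Q by simp
  define b where "b = (\<Sum>y\<in>Y. (1 / card Y) *\<^sub>R y)"
  have b_nth: "b $ j = (\<Sum>y\<in>Y. y $ j) / card Y" for j by (simp add: b_def sum_divide_distrib)
  have "b \<in> A"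
    unfolding b_def using Y(3) Q card_pos by (intro convex_sum Y(1) affine_imp_convex A) auto
  moreover have "0 \<le> b $ j" for j
    unfolding b_nth using Y(3) nonneg by (intro divide_nonneg_nonneg sum_nonneg) auto
  moreover have "b $ j \<noteq> 0" if j: "z $ j \<noteq> 0" for j
  proof -
    obtain y where y: "y \<in> Y" "y $ j \<noteq> 0" using contra j by blast
    have "y $ j \<le> (\<Sum>y\<in>Y. y $ j)" using Y(1,3) y(1) nonneg by (intro member_le_sum) auto
    then show ?thesis using nonneg[of y j] Y(3) y card_pos by (auto simp: b_nth)
  qed
  moreover have "z \<in> A" "\<And>j. 0 \<le> z $ j" using z(1) Q by auto
  ultimately obtain \<epsilon> where \<epsilon>: "0 < \<epsilon>" "(1 + \<epsilon>) *\<^sub>R b + (- \<epsilon>) *\<^sub>R z \<in> A"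
    "\<And>j. 0 \<le> ((1 + \<epsilon>) *\<^sub>R b + (- \<epsilon>) *\<^sub>R z) $ j"
    using nonneg_extend_beyond[OF A, of b z] by metis
  then have in_Q: "(1 + \<epsilon>) *\<^sub>R b + (- \<epsilon>) *\<^sub>R z \<in> Q" unfolding Q by blast
  have "h b = (\<Sum>y\<in>Y. (1 / card Y) * h y)" using h(1) by (simp add: b_def linear_sum linear_scale)
  also have "\<dots> = c" using Y(4) card_pos by simp
  finally have "h ((1 + \<epsilon>) *\<^sub>R b + (- \<epsilon>) *\<^sub>R z) = c - \<epsilon> * (h z - c)"
    using h(1) by (simp add: linear_add linear_diff linear_scale algebra_simps)
  moreover have "0 < \<epsilon> * (h z - c)" using \<epsilon>(1) z(2) by simp
  ultimately show False using h(2)[OF in_Q] by linarith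
qed

lemma separates_facets_component_supports:
  fixes Q :: "(real ^ 'd::finite) set" and p :: "real ^ 'd \<Rightarrow> real ^ 'n::finite"
  assumes ext: "is_subspace_extension Q p permutahedron"
    and sec: "is_section s Q p permutahedron_vertices"
  shows "separates_facets (range (component_support s))"
  unfolding separates_facets_def
proof (intro allI ballI)
  fix S :: "'n set" and \<rho> :: "'n \<Rightarrow> nat" assume \<rho>: "\<rho> \<in> labelings - facet S"
  obtain A where p: "linear p" "p ` Q = permutahedron"
    and A: "affine A" "Q = A \<inter> {y. \<forall>j. 0 \<le> y $ j}"
    using ext unfolding is_subspace_extension_def is_extension_def by blast
  have s: "s (vertex \<sigma>) \<in> Q" "p (s (vertex \<sigma>)) = vertex \<sigma>" if "\<sigma> \<in> labelings" for \<sigma>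
    using sec that unfolding is_section_def by (auto simp: permutahedron_vertices_eq)
  define h where "h = (\<lambda>x. \<Sum>v\<in>S. x $ v) \<circ> p"
  have h_s: "h (s (vertex \<sigma>)) = (\<Sum>v\<in>S. vertex \<sigma> $ v)" if "\<sigma> \<in> labelings" for \<sigma>
    by (simp add: h_def s(2)[OF that])
  have facet: "facet S \<subseteq> labelings" by (auto simp: facet_def)
  have "\<exists>j. s (vertex \<rho>) $ j \<noteq> 0 \<and> (\<forall>y\<in>(\<lambda>\<sigma>. s (vertex \<sigma>)) ` facet S. y $ j = 0)"
  proof (rule ex_coordinate_vanishing_on_face[OF A])
    show "linear h" unfolding h_def using p(1) linear_coordinate_sum by (rule linear_compose)
    show "real (\<Sum>{1..card S}) \<le> h y" if "y \<in> Q" for y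
      unfolding h_def comp_apply using p(2) that by (intro permutahedron_facet_inequality) blast
    show "finite ((\<lambda>\<sigma>. s (vertex \<sigma>)) ` facet S)"
      using finite_subset[OF facet finite_labelings] by simp
    show "(\<lambda>\<sigma>. s (vertex \<sigma>)) ` facet S \<noteq> {}" by (simp add: facet_nonempty)
    show "(\<lambda>\<sigma>. s (vertex \<sigma>)) ` facet S \<subseteq> Q" using s(1) facet by blast
    show "h y = real (\<Sum>{1..card S})" if "y \<in> (\<lambda>\<sigma>. s (vertex \<sigma>)) ` facet S" for y
      using that h_s facet coordinate_sum_vertex_on_facet by fastforce
    show "s (vertex \<rho>) \<in> Q" using s(1) \<rho> by blast
    show "real (\<Sum>{1..card S}) < h (s (vertex \<rho>))"
      using h_s coordinate_sum_vertex_off_facet[OF \<rho>] \<rho> by simp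
  qed
  then obtain j where "\<rho> \<in> component_support s j \<and> component_support s j \<inter> facet S = {}"
    using \<rho> by (auto simp: component_support_def)
  then show "\<exists>X\<in>range (component_support s). \<rho> \<in> X \<and> X \<inter> facet S = {}" by blast
qed

lemma relabel_component_support:
  assumes \<pi>: "bij \<pi>"
    and sym: "\<forall>x\<in>permutahedron_vertices. s (perm_act (inv \<pi>) x) = perm_act \<kappa> (s x)"
  shows "relabel \<pi> (component_support s j) = component_support s (inv \<kappa> j)"
proof -
  have "s (vertex (\<sigma> \<circ> \<pi>)) $ j = s (vertex \<sigma>) $ inv \<kappa> j" if "\<sigma> \<in> labelings" for \<sigma>
  proof -
    have "vertex (\<sigma> \<circ> \<pi>) = perm_act (inv \<pi>) (vertex \<sigma>)"
      using \<pi> by (simp add: vertex_def perm_act_def inv_inv_eq)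
    then have "s (vertex (\<sigma> \<circ> \<pi>)) = perm_act \<kappa> (s (vertex \<sigma>))"
      using sym that by (simp add: permutahedron_vertices_eq)
    then show ?thesis by (simp add: perm_act_def)
  qed
  then show ?thesis by (auto simp: relabel_def component_support_def comp_labeling_iff[OF \<pi>])
qed

theorem theorem3:
  fixes Q :: "(real ^ 'd::finite) set"
    and p :: "real ^ 'd \<Rightarrow> real ^ 'n::finite"
  assumes "CARD('n) \<ge> 6"
    and "is_subspace_extension Q p permutahedron"
    and "weakly_symmetric Q p permutahedron_vertices {\<pi>::'n \<Rightarrow> 'n. bij \<pi>}"
  shows "CARD('d) \<ge> CARD('n) * (CARD('n) - 1) div 2"
proof -
  obtain s where sec: "is_section s Q p permutahedron_vertices"
    and sym: "\<And>\<pi> :: 'n \<Rightarrow> 'n. bij \<pi> \<Longrightarrow> \<exists>\<kappa> :: 'd \<Rightarrow> 'd. bij \<kappa> \<and>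
      (\<forall>x\<in>permutahedron_vertices. s (perm_act \<pi> x) = perm_act \<kappa> (s x))"
    using assms(3) unfolding weakly_symmetric_def by blast
  let ?F = "range (component_support s)"
  have "relabel \<pi> X \<in> ?F" if "X \<in> ?F" "bij \<pi>" for X \<pi>
    using that sym[OF bij_imp_bij_inv[OF that(2)]] relabel_component_support[OF that(2)] by fast
  moreover have "?F \<subseteq> Pow labelings" by (auto simp: component_support_def)
  ultimately have "CARD('n) * (CARD('n) - 1) \<le> 2 * card ?F"
    using separates_facets_component_supports[OF assms(2) sec]
    by (intro card_separating_family assms(1))
  also have "card ?F \<le> CARD('d)" by (rule card_image_le) simp
  finally show ?thesis by simp
qed

end
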